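(* Let $Y$ be a finite dimensional Euclidean space, $K\subseteq Y$ a closed convex cone, $A:\mathbb{R}^m\to Y$ an injective linear map, $b\in Y$, $c\in\mathbb{R}^m$, and consider the problem $$(P)\qquad \sup\ \langle c,x\rangle\quad\text{s.t.}\quad b-Ax\in K.$$ For an integer $k\ge0$ consider the problem $$(D_{\rm ext})\qquad \begin{array}{rl}\inf & \langle b,y_{k+1}\rangle\\ \text{s.t.} & A^*y_{k+1}=c,\\ & A^*y_i=0\ (i=1,\dots,k),\\ & \langle b,y_i\rangle=0\ (i=1,\dots,k),\\ & (y_1,\dots,y_{k+1})\in\mathrm{FR}_{k+1}(K).\end{array}$$ Then for all large enough $k$, $(D_{\rm ext})$ is an exact dual of $(P)$. Moreover, when the optimal value of $(P)$ is finite, for a suitable $k$ the problem $(D_{\rm ext})$ has a pre-strict optimal solution with the same value as $(P)$.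
   Context: $K^*=\{y\in Y:\langle y,x\rangle\ge0\ \forall x\in K\}$, and likewise for other cones; $A^*$ is the adjoint of $A$; $S^\perp$ is the orthogonal complement of the linear span of $S$. For $k\ge1$, $\mathrm{FR}_k(K)=\{(y_1,\dots,y_k): y_1\in K^*,\ y_i\in(K\cap y_1^\perp\cap\dots\cap y_{i-1}^\perp)^*,\ i=2,\dots,k\}$. A sequence $(y_1,\dots,y_k)\in\mathrm{FR}_k(K)$ is strict if for $i=1,\dots,k$, $y_i\in C_i^*\setminus C_i^\perp$ with $C_i=K\cap y_1^\perp\cap\dots\cap y_{i-1}^\perp$ ($C_1=K$); it is pre-strict if $(y_1,\dots,y_{k-1})$ is strict (vacuous when $k=1$). A minimization problem is an exact dual of $(P)$ if (i) weak duality holds: the objective value of any feasible solution of it is at least $\langle c,x\rangle$ for every $x$ feasible in $(P)$; (ii) it has the same optimal value as $(P)$; and (iii) it attains this value when it is finite.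
   Formalization: It is additionally assumed that (P) is feasible or (D_ext) is feasible for some k; otherwise the optimal values are −∞ and +∞ for every k, and the first claim fails. *)

theory Defs
  imports "HOL-Analysis.Analysis"
begin

definition dual_cone :: "'a::euclidean_space set \<Rightarrow> 'a set" where
  "dual_cone C = {y. \<forall>x\<in>C. y \<bullet> x \<ge> 0}"

text \<open>
  A sequence \<open>(y\<^sub>1, \<dots>, y\<^sub>k)\<close> is represented by a function on \<open>nat\<close> of which only the values at
  \<open>1, \<dots>, k\<close> matter. The cone \<open>C\<^sub>i = K \<inter> y\<^sub>1\<^sup>\<bottom> \<inter> \<dots> \<inter> y\<^bsub>i-1\<^esub>\<^sup>\<bottom>\<close> depends only on \<open>y\<^sub>1, \<dots>, y\<^bsub>i-1\<^esub>\<close>,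
  and \<open>C\<^sub>1 = K\<close>.
\<close>

definition fr_cone :: "'a::euclidean_space set \<Rightarrow> (nat \<Rightarrow> 'a) \<Rightarrow> nat \<Rightarrow> 'a set" where
  "fr_cone K y i = K \<inter> (\<Inter>j\<in>{1..<i}. (span {y j})\<^sup>\<bottom>)"

definition FR :: "nat \<Rightarrow> 'a::euclidean_space set \<Rightarrow> (nat \<Rightarrow> 'a) set" where
  "FR k K = {y. \<forall>i\<in>{1..k}. y i \<in> dual_cone (fr_cone K y i)}"

definition strict_seq :: "nat \<Rightarrow> 'a::euclidean_space set \<Rightarrow> (nat \<Rightarrow> 'a) \<Rightarrow> bool" where
  "strict_seq k K y \<longleftrightarrow>
     (\<forall>i\<in>{1..k}. y i \<in> dual_cone (fr_cone K y i) - (span (fr_cone K y i))\<^sup>\<bottom>)"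

definition pre_strict_seq :: "nat \<Rightarrow> 'a::euclidean_space set \<Rightarrow> (nat \<Rightarrow> 'a) \<Rightarrow> bool" where
  "pre_strict_seq k K y \<longleftrightarrow> strict_seq (k - 1) K y"

text \<open>
  Optimal values are extended reals: a maximization problem without feasible points has value
  \<open>-\<infinity>\<close>, a minimization problem without feasible points has value \<open>\<infinity>\<close>.
  As for linear programs, equality of the optimal values can therefore only be expected when the
  two problems are not both infeasible.
\<close>

definition max_value :: "'b set \<Rightarrow> ('b \<Rightarrow> real) \<Rightarrow> ereal" where
  "max_value F f = (SUP x\<in>F. ereal (f x))"

definition min_value :: "'b set \<Rightarrow> ('b \<Rightarrow> real) \<Rightarrow> ereal" where
  "min_value F f = (INF x\<in>F. ereal (f x))"

text \<open>
  The minimization problem with feasible set \<open>G\<close> and objective \<open>g\<close> is an exact dual of the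
  maximization problem with feasible set \<open>F\<close> and objective \<open>f\<close>.
\<close>

definition exact_dual :: "'c set \<Rightarrow> ('c \<Rightarrow> real) \<Rightarrow> 'b set \<Rightarrow> ('b \<Rightarrow> real) \<Rightarrow> bool" where
  "exact_dual G g F f \<longleftrightarrow>
     (\<forall>y\<in>G. \<forall>x\<in>F. g y \<ge> f x) \<and>
     min_value G g = max_value F f \<and>
     (\<bar>min_value G g\<bar> \<noteq> \<infinity> \<longrightarrow> (\<exists>y\<in>G. ereal (g y) = min_value G g))"

definition P_feasible ::
  "'a::euclidean_space set \<Rightarrow> (real^'m \<Rightarrow> 'a) \<Rightarrow> 'a \<Rightarrow> (real^'m) set" where
  "P_feasible K A b = {x. b - A x \<in> K}"

definition Dext_feasible ::
  "'a::euclidean_space set \<Rightarrow> (real^'m \<Rightarrow> 'a) \<Rightarrow> 'a \<Rightarrow> real^'m \<Rightarrow> nat \<Rightarrow> (nat \<Rightarrow> 'a) set" where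
  "Dext_feasible K A b c k =
     {y. adjoint A (y (k + 1)) = c \<and>
         (\<forall>i\<in>{1..k}. adjoint A (y i) = 0) \<and>
         (\<forall>i\<in>{1..k}. b \<bullet> y i = 0) \<and>
         y \<in> FR (k + 1) K}"

end

theory Submission
  imports Defs
begin

text \<open>
  Both the feasible and the infeasible case rest on one extension of Farkas' lemma
  (\<open>extended_farkas\<close>). Let \<open>M\<close> be linear, \<open>C\<close> a closed convex cone, and suppose that
  \<open>g \<bullet> u \<ge> 0\<close> whenever \<open>M u \<in> C\<close>. If the cone \<open>M\<^sup>* C\<^sup>*\<close> is closed, separation
  yields \<open>y \<in> C\<^sup>*\<close> with \<open>M\<^sup>* y = g\<close>. It is closed as soon as every \<open>y \<in> C\<^sup>*\<close> with
  \<open>M\<^sup>* y = 0\<close> is orthogonal to all of \<open>C\<close>, because the kernel of \<open>M\<^sup>*\<close> then meets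
  \<open>C\<^sup>*\<close> in a linear subspace (\<open>closed_linear_image_cone\<close>). Otherwise some \<open>y \<in> C\<^sup>*\<close>
  with \<open>M\<^sup>* y = 0\<close> is not orthogonal to \<open>C\<close>. All points \<open>M u\<close> lie in \<open>y\<^sup>\<bottom>\<close>, so
  the hypothesis survives when \<open>C\<close> is replaced by its face \<open>C \<inter> y\<^sup>\<bottom>\<close>, whose dimension is
  smaller. The vectors \<open>y\<close> collected in this way form a strict facial reduction sequence.

  Take \<open>M (t, x) = t b - A x\<close>, so that \<open>M\<^sup>* y = (b \<bullet> y, - A\<^sup>* y)\<close>. If \<open>(P)\<close> is feasible
  with finite value \<open>v\<close>, then \<open>g = (v, - c)\<close> satisfies the hypothesis, and the resulting
  sequence is a pre-strict feasible solution of the extended dual with value \<open>v\<close>; by weak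
  duality it is optimal. If \<open>(P)\<close> is infeasible, then \<open>g = (-1, 0)\<close> satisfies the hypothesis.
  The result is a sequence that is feasible for right-hand side \<open>0\<close> and has objective value \<open>-1\<close>.
  Facial reduction sequences can be concatenated, since shrinking a cone enlarges its dual, and
  the final vectors can then be added, the second one with an arbitrarily large factor. So any
  feasible solution of the extended dual can be improved without bound, and the dual value is
  \<open>-\<infinity>\<close>. Concatenation with zero sequences shows that all these conclusions persist
  for larger \<open>k\<close>.
\<close>

section \<open>Dual cones and separation\<close>

lemma mem_orthogonal_comp_span:
  "y \<in> (span S)\<^sup>\<bottom> \<longleftrightarrow> (\<forall>x\<in>S. y \<bullet> x = 0)"
proof
  assume "\<forall>x\<in>S. y \<bullet> x = 0"
  then have "\<And>x. x \<in> S \<Longrightarrow> orthogonal y x"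
    by (simp add: orthogonal_def)
  then have "\<And>x. x \<in> span S \<Longrightarrow> orthogonal y x"
    using orthogonal_to_span by blast
  then show "y \<in> (span S)\<^sup>\<bottom>"
    by (simp add: orthogonal_comp_def orthogonal_commute)
qed (auto simp: orthogonal_comp_def orthogonal_def span_base inner_commute)

lemma dual_cone_antimono: "C \<subseteq> D \<Longrightarrow> dual_cone D \<subseteq> dual_cone C"
  by (auto simp: dual_cone_def)

lemma convex_cone_dual_cone: "convex_cone (dual_cone C)"
  by (auto simp: convex_cone_iff dual_cone_def inner_add_left)

lemma closed_dual_cone: "closed (dual_cone C)"
proof -
  have "dual_cone C = (\<Inter>x\<in>C. {y. x \<bullet> y \<ge> 0})"
    by (auto simp: dual_cone_def inner_commute)
  then show ?thesis
    by (simp add: closed_INT closed_halfspace_ge)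
qed

lemma separating_halfspace_closed_cone:
  fixes S :: "'a::euclidean_space set"
  assumes "closed S" "convex_cone S" "z \<notin> S"
  obtains a where "a \<in> dual_cone S" "a \<bullet> z < 0"
proof -
  obtain a r where a: "a \<bullet> z < r" "\<And>x. x \<in> S \<Longrightarrow> a \<bullet> x > r"
    using separating_hyperplane_closed_point[of S z] assms by (auto simp: convex_cone_def)
  have "r < 0"
    using a(2)[of 0] assms(2) by (simp add: convex_cone_contains_0)
  have "a \<bullet> x \<ge> 0" if "x \<in> S" for x
  proof (rule ccontr)
    assume neg: "\<not> a \<bullet> x \<ge> 0"
    \<comment> \<open>The multiple of \<open>x\<close> on which \<open>a\<close> takes the value \<open>r\<close> still lies in the cone.\<close>
    have "(r / (a \<bullet> x)) *\<^sub>R x \<in> S"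
      using assms(2) that neg \<open>r < 0\<close>
      by (intro convex_cone_scaleR) (auto intro: divide_nonpos_nonpos)
    from a(2)[OF this] neg show False
      by simp
  qed
  then have "a \<in> dual_cone S"
    by (simp add: dual_cone_def)
  with a(1) \<open>r < 0\<close> show ?thesis
    by (intro that) auto
qed

lemma bipolar:
  fixes C :: "'a::euclidean_space set"
  assumes "closed C" "convex_cone C" and "\<And>y. y \<in> dual_cone C \<Longrightarrow> y \<bullet> x \<ge> 0"
  shows "x \<in> C"
  by (metis assms separating_halfspace_closed_cone not_le)

section \<open>Closedness of linear images of cones\<close>

text \<open>
  The image is the conic hull of the image of the unit vectors of \<open>T\<close>, a compact set that
  avoids the origin.
\<close>
lemma closed_linear_image_cone_trivial_kernel:
  fixes f :: "'a::euclidean_space \<Rightarrow> 'b::euclidean_space"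
  assumes "closed T" "convex_cone T" "linear f"
    and ker: "\<And>x. x \<in> T \<Longrightarrow> f x = 0 \<Longrightarrow> x = 0"
  shows "closed (f ` T)"
proof -
  let ?B = "T \<inter> sphere 0 1"
  have "compact (f ` ?B)"
    using assms by (intro compact_continuous_image linear_continuous_on closed_Int_compact)
      (auto simp: linear_conv_bounded_linear)
  moreover have "0 \<notin> f ` ?B"
    using ker by fastforce
  ultimately have "closed (conic hull (f ` ?B))"
    by (intro closed_conic_hull) auto
  \<comment> \<open>If \<open>T = {0}\<close>, there are no unit vectors and the conic hull is empty.\<close>
  moreover have "f ` T = insert 0 (conic hull (f ` ?B))"
  proof (intro set_eqI iffI)
    fix z assume "z \<in> f ` T"
    then obtain x where x: "x \<in> T" "z = f x"
      by blast
    show "z \<in> insert 0 (conic hull (f ` ?B))"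
    proof (cases "x = 0")
      case True
      then show ?thesis
        using x linear_0[OF assms(3)] by simp
    next
      case False
      have "(1 / norm x) *\<^sub>R x \<in> ?B"
        using x False assms(2) by (auto intro: convex_cone_scaleR)
      then have "norm x *\<^sub>R f ((1 / norm x) *\<^sub>R x) \<in> conic hull (f ` ?B)"
        unfolding conic_hull_explicit by (metis (mono_tags, lifting) image_eqI mem_Collect_eq norm_ge_zero)
      then show ?thesis
        using x False by (simp add: linear_scale[OF assms(3)])
    qed
  next
    fix z assume "z \<in> insert 0 (conic hull (f ` ?B))"
    then consider "z = 0" | r x where "r \<ge> 0" "x \<in> T" "z = r *\<^sub>R f x"
      by (auto simp: conic_hull_explicit)
    then show "z \<in> f ` T"
    proof cases
      case 1
      then show ?thesis
        using assms(2) linear_0[OF assms(3)] convex_cone_contains_0 by (metis image_eqI)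
    next
      case (2 r x)
      then have "z = f (r *\<^sub>R x)" "r *\<^sub>R x \<in> T"
        using assms(2) by (auto simp: linear_scale[OF assms(3)] convex_cone_scaleR)
      then show ?thesis
        by blast
    qed
  qed
  ultimately show ?thesis
    by simp
qed

text \<open>
  The part of \<open>S\<close> in the kernel of \<open>f\<close> is a subspace \<open>N\<close>. Projecting \<open>S\<close> along \<open>N\<close>
  changes neither membership in \<open>S\<close> nor the image under \<open>f\<close>, which reduces the claim to
  \<open>S \<inter> N\<^sup>\<bottom>\<close>, where the kernel is trivial.
\<close>
lemma closed_linear_image_cone:
  fixes f :: "'a::euclidean_space \<Rightarrow> 'b::euclidean_space"
  assumes "closed S" "convex_cone S" "linear f"
    and ker: "\<And>x. x \<in> S \<Longrightarrow> f x = 0 \<Longrightarrow> - x \<in> S"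
  shows "closed (f ` S)"
proof -
  define N where "N = {x \<in> S. f x = 0}"
  have sub: "subspace N"
    unfolding subspace_convex_cone_symmetric using assms
    by (auto simp: N_def convex_cone_iff linear_0 linear_add linear_scale linear_neg)
  define T where "T = S \<inter> N\<^sup>\<bottom>"
  have "closed (f ` T)"
  proof (rule closed_linear_image_cone_trivial_kernel)
    show "closed T"
      unfolding T_def using assms(1) closed_subspace[OF subspace_orthogonal_comp] by blast
    show "convex_cone T"
      using assms(2) subspace_imp_convex_cone[OF subspace_orthogonal_comp, of N]
      by (auto simp: T_def convex_cone_iff)
    show "x = 0" if "x \<in> T" "f x = 0" for x
    proof -
      have "x \<in> N \<inter> N\<^sup>\<bottom>"
        using that by (auto simp: T_def N_def)
      then show ?thesis
        using orthogonal_Int_0[OF sub] by blast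
    qed
  qed (use assms in auto)
  moreover have "f ` S = f ` T"
  proof
    show "f ` S \<subseteq> f ` T"
    proof clarify
      fix x assume "x \<in> S"
      obtain n t where nt: "x = n + t" "n \<in> N" "t \<in> N\<^sup>\<bottom>"
        using subspace_sum_orthogonal_comp[OF sub] by (metis UNIV_I set_plus_elim)
      have "- n \<in> S"
        using nt(2) ker by (auto simp: N_def)
      then have "x + (- n) \<in> S"
        using \<open>x \<in> S\<close> assms(2) convex_cone_add by blast
      then have "t \<in> T"
        using nt by (simp add: T_def)
      moreover have "f x = f t"
        using nt by (simp add: N_def linear_add[OF assms(3)])
      ultimately show "f x \<in> f ` T"
        by blast
    qed
  qed (auto simp: T_def)
  ultimately show ?thesis
    by simp
qed

section \<open>Facial reduction sequences\<close>

lemma fr_cone_iff: "x \<in> fr_cone K y i \<longleftrightarrow> x \<in> K \<and> (\<forall>j\<in>{1..<i}. x \<bullet> y j = 0)"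
  by (auto simp: fr_cone_def mem_orthogonal_comp_span)

lemma fr_cone_prepend:
  assumes "\<And>j. 1 \<le> j \<Longrightarrow> w (Suc j) = y j" and "1 \<le> i"
  shows "fr_cone K w (Suc i) = fr_cone (K \<inter> {x. x \<bullet> w 1 = 0}) y i"
proof -
  have "{1..<Suc i} = insert 1 (Suc ` {1..<i})"
    using assms(2) by (auto simp: image_Suc_atLeastLessThan)
  then have "(\<forall>j\<in>{1..<Suc i}. x \<bullet> w j = 0) \<longleftrightarrow>
      x \<bullet> w 1 = 0 \<and> (\<forall>j\<in>{1..<i}. x \<bullet> y j = 0)" for x
    using assms(1) by (simp only: ball_simps) simp
  then show ?thesis
    by (auto simp: fr_cone_iff simp del: One_nat_def)
qed

text \<open>
  The induction is on the dimension of \<open>C\<close>: as long as \<open>M\<^sup>* C\<^sup>*\<close> cannot be shown to be closed,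
  there is a vector that cuts a face of smaller dimension out of \<open>C\<close>, and it is put in front of
  the sequence obtained for that face.
\<close>
theorem extended_farkas:
  fixes M :: "'b::euclidean_space \<Rightarrow> 'a::euclidean_space"
  assumes "closed C" "convex_cone C" "linear M"
    and "\<And>u. M u \<in> C \<Longrightarrow> g \<bullet> u \<ge> 0"
  shows "\<exists>k y. strict_seq k C y \<and> (\<forall>i\<in>{1..k}. adjoint M (y i) = 0) \<and>
           y (Suc k) \<in> dual_cone (fr_cone C y (Suc k)) \<and> adjoint M (y (Suc k)) = g"
  using assms(1,2,4)
proof (induction "dim C" arbitrary: C rule: less_induct)
  case less
  show ?case
  proof (cases "\<exists>y\<in>dual_cone C. adjoint M y = 0 \<and> y \<notin> (span C)\<^sup>\<bottom>")
    case True
    then obtain e where e: "e \<in> dual_cone C" "adjoint M e = 0" "e \<notin> (span C)\<^sup>\<bottom>"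
      by blast
    define F where "F = C \<inter> {x. x \<bullet> e = 0}"
    obtain x where x: "x \<in> C" "e \<bullet> x \<noteq> 0"
      using e(3) by (auto simp: mem_orthogonal_comp_span)
    have "span F \<subseteq> {x. x \<bullet> e = 0}"
      by (intro span_minimal) (auto simp: F_def subspace_def inner_add_left)
    then have "x \<notin> span F"
      using x by (auto simp: inner_commute)
    then have "span F \<subset> span C"
      using span_mono[of F C] span_base[OF x(1)] by (auto simp: F_def)
    then have dim: "dim F < dim C"
      by (rule dim_psubset)
    have "closed F"
      unfolding F_def using less.prems(1) closed_hyperplane[of e 0]
      by (intro closed_Int) (auto simp: inner_commute)
    moreover have "convex_cone F"
      using less.prems(2) by (auto simp: F_def convex_cone_iff inner_add_left)
    ultimately obtain k y where y: "strict_seq k F y" "\<forall>i\<in>{1..k}. adjoint M (y i) = 0"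
        "y (Suc k) \<in> dual_cone (fr_cone F y (Suc k))" "adjoint M (y (Suc k)) = g"
      using less.hyps[OF dim] less.prems(3) by (auto simp: F_def)
    define w where "w i = (if i = 1 then e else y (i - 1))" for i
    have w1: "w 1 = e" and wS: "\<And>j. 1 \<le> j \<Longrightarrow> w (Suc j) = y j"
      by (auto simp: w_def)
    have cone: "fr_cone C w (Suc i) = fr_cone F y i" if "1 \<le> i" for i
      using fr_cone_prepend[of w y i C] wS that by (simp add: F_def w1[unfolded One_nat_def])
    have cone1: "fr_cone C w 1 = C"
      by (auto simp: fr_cone_iff)
    have split: "{1..Suc k} = insert 1 (Suc ` {1..k})"
      by (auto simp: image_Suc_atLeastAtMost)
    have "strict_seq (Suc k) C w"
      unfolding strict_seq_def split ball_simps using e y(1) cone wS cone1 w1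
      by (simp add: strict_seq_def)
    moreover have "\<forall>i\<in>{1..Suc k}. adjoint M (w i) = 0"
      unfolding split ball_simps using e(2) y(2) wS w1 by simp
    ultimately show ?thesis
      using y(3,4) cone[of "Suc k"] wS[of "Suc k"] by (intro exI[of _ "Suc k"] exI[of _ w]) simp
  next
    case False
    have adj: "linear (adjoint M)"
      using assms(3) by (rule adjoint_linear)
    have "closed (adjoint M ` dual_cone C)"
    proof (rule closed_linear_image_cone[OF closed_dual_cone convex_cone_dual_cone adj])
      show "- y \<in> dual_cone C" if "y \<in> dual_cone C" "adjoint M y = 0" for y
        using False that by (auto simp: mem_orthogonal_comp_span dual_cone_def)
    qed
    moreover have "convex_cone (adjoint M ` dual_cone C)"
      using convex_cone_linear_image convex_cone_dual_cone adj by blast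
    moreover have "u \<bullet> g \<ge> 0" if "u \<in> dual_cone (adjoint M ` dual_cone C)" for u
    proof -
      have "y \<bullet> M u \<ge> 0" if "y \<in> dual_cone C" for y
        using \<open>u \<in> _\<close> that
        by (auto simp: dual_cone_def adjoint_works[OF assms(3)] inner_commute[of y])
      then have "M u \<in> C"
        by (rule bipolar[OF less.prems(1,2)])
      then show ?thesis
        using less.prems(3) by (metis inner_commute)
    qed
    ultimately have "g \<in> adjoint M ` dual_cone C"
      by (rule bipolar)
    then obtain y where "y \<in> dual_cone C" "adjoint M y = g"
      by blast
    then show ?thesis
      by (intro exI[of _ 0] exI[of _ "\<lambda>_. y"]) (auto simp: strict_seq_def fr_cone_def)
  qed
qed

section \<open>The extended dual\<close>

text \<open>
  The first \<open>k\<close> vectors annihilate the slack \<open>b - A x\<close> of a feasible \<open>x\<close>, so the slack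
  stays in all the cones of the sequence.
\<close>
lemma weak_duality:
  fixes A :: "real^'m \<Rightarrow> 'a::euclidean_space"
  assumes "linear A" and y: "y \<in> Dext_feasible K A b c k" and x: "x \<in> P_feasible K A b"
  shows "c \<bullet> x \<le> b \<bullet> y (k + 1)"
proof -
  have *: "(b - A x) \<bullet> y i = b \<bullet> y i - x \<bullet> adjoint A (y i)" for i
    by (simp add: adjoint_works[OF assms(1)] inner_diff_left)
  have "b - A x \<in> fr_cone K y (k + 1)"
    using x y by (auto simp: fr_cone_iff Dext_feasible_def P_feasible_def *)
  moreover have "y (k + 1) \<in> dual_cone (fr_cone K y (k + 1))"
    using y by (auto simp: Dext_feasible_def FR_def)
  ultimately have "(b - A x) \<bullet> y (k + 1) \<ge> 0"
    by (auto simp: dual_cone_def inner_commute)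
  then show ?thesis
    using y *[of "k + 1"] by (simp add: Dext_feasible_def inner_commute[of c])
qed

text \<open>
  The reducing vectors of \<open>z\<close> are followed by those of \<open>y\<close>. A cone of the combined sequence is
  contained in the cone that belongs to the same vector in \<open>z\<close> or \<open>y\<close>, so its dual is larger.
  The last cone is contained in the last cones of both sequences, hence its dual contains both
  final vectors and their conic combinations.
\<close>
lemma Dext_feasible_add:
  fixes A :: "real^'m \<Rightarrow> 'a::euclidean_space"
  assumes "linear A" and y: "y \<in> Dext_feasible K A b c k" and z: "z \<in> Dext_feasible K A b 0 l"
    and "s \<ge> 0"
  shows "\<exists>w\<in>Dext_feasible K A b c (l + k).
           b \<bullet> w (l + k + 1) = b \<bullet> y (k + 1) + s * (b \<bullet> z (l + 1))"
proof -
  have adj: "linear (adjoint A)"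
    using assms(1) by (rule adjoint_linear)
  define w where "w i = (if i \<le> l then z i else if i \<le> l + k then y (i - l)
                         else y (k + 1) + s *\<^sub>R z (l + 1))" for i
  have w1: "w i = z i" if "i \<le> l" for i
    using that by (simp add: w_def)
  have w2: "w (l + i) = y i" if "1 \<le> i" "i \<le> k" for i
    using that by (simp add: w_def)
  have w3: "w (l + k + 1) = y (k + 1) + s *\<^sub>R z (l + 1)"
    by (simp add: w_def)
  have coneZ: "fr_cone K w i \<subseteq> fr_cone K z j" if "j \<le> i" "j \<le> l + 1" for i j
  proof
    fix x assume "x \<in> fr_cone K w i"
    then have "x \<in> K" "\<And>a. 1 \<le> a \<Longrightarrow> a < i \<Longrightarrow> x \<bullet> w a = 0"
      by (auto simp: fr_cone_iff)
    moreover have "w a = z a" "a < i" if "a < j" for a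
      using \<open>a < j\<close> \<open>j \<le> i\<close> \<open>j \<le> l + 1\<close> by (auto intro: w1)
    ultimately show "x \<in> fr_cone K z j"
      by (metis atLeastLessThan_iff fr_cone_iff)
  qed
  have coneY: "fr_cone K w (l + i) \<subseteq> fr_cone K y i" if "1 \<le> i" "i \<le> k + 1" for i
  proof
    fix x assume x: "x \<in> fr_cone K w (l + i)"
    have "x \<bullet> y j = 0" if j: "1 \<le> j" "j < i" for j
    proof -
      have "x \<bullet> w (l + j) = 0"
        using x j by (auto simp: fr_cone_iff)
      then show ?thesis
        using w2[of j] j \<open>i \<le> k + 1\<close> by simp
    qed
    then show "x \<in> fr_cone K y i"
      using x by (auto simp: fr_cone_iff)
  qed
  have yd: "y i \<in> dual_cone (fr_cone K w (l + i))" if "1 \<le> i" "i \<le> k + 1" for i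
    using y that dual_cone_antimono[OF coneY[OF that]] by (auto simp: Dext_feasible_def FR_def)
  have zd: "z j \<in> dual_cone (fr_cone K w i)" if "1 \<le> j" "j \<le> i" "j \<le> l + 1" for i j
    using z that dual_cone_antimono[OF coneZ[OF that(2,3)]]
    by (auto simp: Dext_feasible_def FR_def)
  have cases: "i \<le> l \<or> (\<exists>j. i = l + j \<and> 1 \<le> j \<and> j \<le> k)" if "i \<le> l + k" for i
    using that by presburger
  have "w (l + k + 1) \<in> dual_cone (fr_cone K w (l + k + 1))"
    unfolding w3 using yd[of "k + 1"] zd[of "l + 1" "l + k + 1"] assms(4)
    by (intro convex_cone_add convex_cone_scaleR convex_cone_dual_cone)
      (simp_all add: add.assoc)
  moreover have "w i \<in> dual_cone (fr_cone K w i)" if "1 \<le> i" "i \<le> l + k" for i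
    using cases[OF that(2)] that w1 w2 yd zd by auto
  ultimately have "w \<in> FR (l + k + 1) K"
    unfolding FR_def by (auto simp: le_Suc_eq)
  moreover have "adjoint A (w i) = 0 \<and> b \<bullet> w i = 0" if "1 \<le> i" "i \<le> l + k" for i
    using cases[OF that(2)] that w1 w2 y z by (auto simp: Dext_feasible_def)
  moreover have "adjoint A (w (l + k + 1)) = c"
    using y z by (simp only: w3) (simp add: Dext_feasible_def linear_add[OF adj] linear_scale[OF adj])
  ultimately have "w \<in> Dext_feasible K A b c (l + k)"
    by (auto simp: Dext_feasible_def)
  then show ?thesis
    using w3 by (intro bexI[of _ w]) (auto simp: inner_add_right)
qed

text \<open>Reducing by the zero vector leaves a cone unchanged, so sequences can be padded with zeros.\<close>
lemma Dext_feasible_mono: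
  fixes A :: "real^'m \<Rightarrow> 'a::euclidean_space"
  assumes "linear A" and "y \<in> Dext_feasible K A b c k" and "k \<le> n"
  shows "\<exists>w\<in>Dext_feasible K A b c n. b \<bullet> w (n + 1) = b \<bullet> y (k + 1)"
proof -
  have "(\<lambda>_. 0) \<in> Dext_feasible K A b 0 (n - k)"
    using linear_0[OF adjoint_linear[OF assms(1)]]
    by (auto simp: Dext_feasible_def FR_def dual_cone_def)
  from Dext_feasible_add[OF assms(1,2) this, of 0] assms(3) show ?thesis
    by simp
qed

text \<open>
  The pairs \<open>(t, x)\<close> homogenize the constraint \<open>b - A x \<in> K\<close>; a functional on them
  is the objective value \<open>r\<close> together with the right-hand side \<open>d\<close> of the dual.
\<close>
lemma Dext_feasible_of_homogenized_bound:
  fixes A :: "real^'m \<Rightarrow> 'a::euclidean_space"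
  assumes "closed K" "convex_cone K" "linear A"
    and bound: "\<And>t x. t *\<^sub>R b - A x \<in> K \<Longrightarrow> d \<bullet> x \<le> t * r"
  shows "\<exists>k. \<exists>y\<in>Dext_feasible K A b d k. pre_strict_seq (k + 1) K y \<and> b \<bullet> y (k + 1) = r"
proof -
  define M where "M u = fst u *\<^sub>R b - A (snd u)" for u
  have lin: "linear M"
    using assms(3)
    by (intro linearI) (auto simp: M_def linear_add linear_scale algebra_simps)
  have "(r, - d) \<bullet> u \<ge> 0" if "M u \<in> K" for u
    using bound[of "fst u" "snd u"] that by (cases u) (simp add: M_def mult.commute)
  from extended_farkas[OF assms(1,2) lin this] obtain k y where
    y: "strict_seq k K y" "\<forall>i\<in>{1..k}. adjoint M (y i) = 0"
      "y (Suc k) \<in> dual_cone (fr_cone K y (Suc k))" "adjoint M (y (Suc k)) = (r, - d)"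
    by blast
  have adjM: "adjoint M v = (b \<bullet> v, - adjoint A v)" for v
  proof -
    have "u \<bullet> adjoint M v = u \<bullet> (b \<bullet> v, - adjoint A v)" for u
      by (cases u) (simp add: adjoint_works[OF lin] M_def inner_diff_left
          adjoint_works[OF assms(3)])
    then show ?thesis
      using vector_eq_ldot by blast
  qed
  have "y \<in> FR (k + 1) K"
    using y(1,3) by (auto simp: FR_def strict_seq_def le_Suc_eq)
  then have "y \<in> Dext_feasible K A b d k"
    using y(2,4) by (auto simp: Dext_feasible_def adjM prod_eq_iff)
  moreover have "pre_strict_seq (k + 1) K y" "b \<bullet> y (k + 1) = r"
    using y(1,4) by (auto simp: pre_strict_seq_def adjM)
  ultimately show ?thesis
    by blast
qed

text \<open>
  The coefficient \<open>t\<close> of \<open>b\<close> may be nonpositive, so scaling alone does not produce a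
  feasible point. Adding a large multiple \<open>q\<close> of a nearly optimal slack \<open>b - A x0\<close> makes the
  coefficient \<open>p = t + q\<close> positive. The bound obtained for the sum,
  \<open>c \<bullet> x + q (c \<bullet> x0) \<le> (t + q) v\<close>, gives the claim up to the error \<open>q (v - c \<bullet> x0)\<close>,
  which can be made arbitrarily small while \<open>q\<close> is kept fixed.
\<close>
lemma homogenized_bound_of_finite_value:
  fixes A :: "real^'m \<Rightarrow> 'a::euclidean_space"
  assumes "convex_cone K" "linear A"
    and sup: "\<And>x. x \<in> P_feasible K A b \<Longrightarrow> c \<bullet> x \<le> v"
    and approx: "\<And>e. e > 0 \<Longrightarrow> \<exists>x\<in>P_feasible K A b. c \<bullet> x > v - e"
    and tx: "t *\<^sub>R b - A x \<in> K"
  shows "c \<bullet> x \<le> t * v"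
proof (rule ccontr)
  assume neg: "\<not> c \<bullet> x \<le> t * v"
  define q where "q = \<bar>t\<bar> + 1"
  define p where "p = t + q"
  have q: "q > 0" and p: "p > 0"
    by (auto simp: q_def p_def)
  define e where "e = c \<bullet> x - t * v"
  obtain x0 where x0: "x0 \<in> P_feasible K A b" "c \<bullet> x0 > v - e / q"
    using approx[of "e / q"] neg q by (auto simp: e_def)
  have "t *\<^sub>R b - A x + q *\<^sub>R (b - A x0) \<in> K"
    using assms(1) tx x0(1) q
    by (intro convex_cone_add convex_cone_scaleR) (auto simp: P_feasible_def)
  then have "(1 / p) *\<^sub>R (t *\<^sub>R b - A x + q *\<^sub>R (b - A x0)) \<in> K"
    using assms(1) p by (intro convex_cone_scaleR) auto
  moreover have "(1 / p) *\<^sub>R (t *\<^sub>R b - A x + q *\<^sub>R (b - A x0))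
      = b - A ((1 / p) *\<^sub>R (x + q *\<^sub>R x0))"
  proof -
    have "t *\<^sub>R b - A x + q *\<^sub>R (b - A x0) = p *\<^sub>R b - A (x + q *\<^sub>R x0)"
      using assms(2) by (simp add: linear_add linear_scale p_def algebra_simps)
    then show ?thesis
      using assms(2) p by (simp add: linear_scale scaleR_diff_right)
  qed
  ultimately have "c \<bullet> ((1 / p) *\<^sub>R (x + q *\<^sub>R x0)) \<le> v"
    by (intro sup) (simp add: P_feasible_def)
  then have "c \<bullet> x + q * (c \<bullet> x0) \<le> p * v"
    using p by (simp add: inner_add_right field_simps)
  moreover have "q * (c \<bullet> x0) > q * v - e"
    using mult_strict_left_mono[OF x0(2) q] q by (simp add: right_diff_distrib)
  ultimately show False
    by (simp add: p_def e_def algebra_simps)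
qed

section \<open>Exact duality\<close>

lemma exact_dualI_attained:
  assumes "\<And>y x. y \<in> G \<Longrightarrow> x \<in> F \<Longrightarrow> f x \<le> g y"
    and "y \<in> G" and "ereal (g y) = max_value F f"
  shows "exact_dual G g F f" and "min_value G g = ereal (g y)"
proof -
  have "max_value F f \<le> min_value G g"
    using assms(1) by (auto simp: max_value_def min_value_def intro!: SUP_least INF_greatest)
  moreover have "min_value G g \<le> ereal (g y)"
    using assms(2) by (auto simp: min_value_def intro: INF_lower)
  ultimately show "min_value G g = ereal (g y)"
    using assms(3) by simp
  then show "exact_dual G g F f"
    using assms by (auto simp: exact_dual_def)
qed

text \<open>
  The bound \<open>0 \<le> - t\<close> required for the right-hand side \<open>0\<close> and value \<open>-1\<close> holds because \<open>t b - A x \<in> K\<close> with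
  \<open>t > 0\<close> would make \<open>x / t\<close> feasible.
\<close>
lemma infeasibility_certificate:
  fixes A :: "real^'m \<Rightarrow> 'a::euclidean_space"
  assumes "closed K" "convex_cone K" "linear A" "P_feasible K A b = {}"
  shows "\<exists>l. \<exists>z\<in>Dext_feasible K A b 0 l. b \<bullet> z (l + 1) = -1"
proof -
  have "0 \<bullet> x \<le> t * (-1)" if tx: "t *\<^sub>R b - A x \<in> K" for t and x :: "real^'m"
  proof (rule ccontr)
    assume "\<not> 0 \<bullet> x \<le> t * (-1)"
    then have t: "t > 0"
      by simp
    have "(1 / t) *\<^sub>R (t *\<^sub>R b - A x) \<in> K"
      using assms(2) t tx by (intro convex_cone_scaleR) auto
    then have "(1 / t) *\<^sub>R x \<in> P_feasible K A b"
      using t assms(3) by (simp add: P_feasible_def linear_scale scaleR_diff_right)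
    then show False
      using assms(4) by blast
  qed
  from Dext_feasible_of_homogenized_bound[OF assms(1-3) this] show ?thesis
    by blast
qed

lemma finite_value_attained:
  fixes A :: "real^'m \<Rightarrow> 'a::euclidean_space"
  assumes "closed K" "convex_cone K" "linear A"
    and fin: "\<bar>max_value (P_feasible K A b) (\<lambda>x. c \<bullet> x)\<bar> \<noteq> \<infinity>"
  shows "\<exists>k. \<exists>y\<in>Dext_feasible K A b c k. pre_strict_seq (k + 1) K y \<and>
           ereal (b \<bullet> y (k + 1)) = max_value (P_feasible K A b) (\<lambda>x. c \<bullet> x)"
proof -
  obtain v where v: "max_value (P_feasible K A b) (\<lambda>x. c \<bullet> x) = ereal v"
    using fin by auto
  have sup: "c \<bullet> x \<le> v" if "x \<in> P_feasible K A b" for x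
  proof -
    have "ereal (c \<bullet> x) \<le> max_value (P_feasible K A b) (\<lambda>x. c \<bullet> x)"
      unfolding max_value_def using that by (rule SUP_upper)
    then show ?thesis
      by (simp add: v)
  qed
  have approx: "\<exists>x\<in>P_feasible K A b. c \<bullet> x > v - e" if "e > 0" for e
  proof -
    have "ereal (v - e) < max_value (P_feasible K A b) (\<lambda>x. c \<bullet> x)"
      using that by (simp add: v)
    then show ?thesis
      unfolding max_value_def by (auto simp: less_SUP_iff)
  qed
  have "c \<bullet> x \<le> t * v" if "t *\<^sub>R b - A x \<in> K" for t x
    using homogenized_bound_of_finite_value[OF assms(2,3) sup approx that] by blast
  from Dext_feasible_of_homogenized_bound[OF assms(1-3) this] show ?thesis
    by (simp add: v)
qed

theorem theorem2:
  fixes K :: "'a::euclidean_space set"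
    and A :: "real^'m \<Rightarrow> 'a"
    and b :: 'a
    and c :: "real^'m"
  assumes "closed K" and "convex_cone K"
    and "linear A" and "inj A"
    and not_both_infeasible:
      "P_feasible K A b \<noteq> {} \<or> (\<exists>k. Dext_feasible K A b c k \<noteq> {})"
  shows
    "(\<exists>k0. \<forall>k\<ge>k0.
        exact_dual (Dext_feasible K A b c k) (\<lambda>y. b \<bullet> y (k + 1))
                   (P_feasible K A b) (\<lambda>x. c \<bullet> x)) \<and>
     (\<bar>max_value (P_feasible K A b) (\<lambda>x. c \<bullet> x)\<bar> \<noteq> \<infinity> \<longrightarrow>
        (\<exists>k. \<exists>y\<in>Dext_feasible K A b c k.
           pre_strict_seq (k + 1) K y \<and>
           ereal (b \<bullet> y (k + 1)) = min_value (Dext_feasible K A b c k) (\<lambda>y. b \<bullet> y (k + 1)) \<and>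
           ereal (b \<bullet> y (k + 1)) = max_value (P_feasible K A b) (\<lambda>x. c \<bullet> x)))"
proof -
  let ?F = "P_feasible K A b" and ?f = "\<lambda>x. c \<bullet> x"
  let ?G = "\<lambda>k. Dext_feasible K A b c k" and ?g = "\<lambda>k y. b \<bullet> y (k + 1)"
  have weak: "?f x \<le> ?g k y" if "y \<in> ?G k" "x \<in> ?F" for x y k
    using weak_duality[OF assms(3) that] .
  consider (empty) "?F = {}" | (unbounded) "?F \<noteq> {}" "max_value ?F ?f = \<infinity>"
    | (bounded) "\<bar>max_value ?F ?f\<bar> \<noteq> \<infinity>"
  proof -
    have "max_value ?F ?f \<noteq> -\<infinity>" if "x \<in> ?F" for x
      using SUP_upper[of x ?F "\<lambda>x. ereal (?f x)"] that by (auto simp: max_value_def)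
    then show ?thesis
      using that by fastforce
  qed
  then have "\<exists>k0. \<forall>k\<ge>k0. exact_dual (?G k) (?g k) ?F ?f"
  proof cases
    case empty
    then obtain k0 y where y: "y \<in> ?G k0"
      using not_both_infeasible by blast
    obtain l z where z: "z \<in> Dext_feasible K A b 0 l" "b \<bullet> z (l + 1) = -1"
      using infeasibility_certificate[OF assms(1-3) empty] by blast
    have "exact_dual (?G k) (?g k) ?F ?f" if k: "k \<ge> l + k0" for k
    proof -
      have "min_value (?G k) (?g k) \<le> ereal r" for r
      proof -
        \<comment> \<open>Each unit of the certificate lowers the objective by one.\<close>
        define s where "s = max 0 (b \<bullet> y (k0 + 1) - r)"
        obtain w where w: "w \<in> ?G (l + k0)"
            "b \<bullet> w (l + k0 + 1) = b \<bullet> y (k0 + 1) + s * (b \<bullet> z (l + 1))"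
          using Dext_feasible_add[OF assms(3) y z(1), of s] by (auto simp: s_def)
        obtain w' where w': "w' \<in> ?G k" "?g k w' = b \<bullet> w (l + k0 + 1)"
          using Dext_feasible_mono[OF assms(3) w(1) k] by metis
        have "?g k w' \<le> r"
          using w' w(2) z(2) by (simp add: s_def)
        then show ?thesis
          unfolding min_value_def using w'(1) by (intro INF_lower2[of w']) auto
      qed
      then have "min_value (?G k) (?g k) = -\<infinity>"
        by (rule ereal_bot)
      then show ?thesis
        using empty by (simp add: exact_dual_def max_value_def bot_ereal_def)
    qed
    then show ?thesis
      by blast
  next
    case unbounded
    have "?G k = {}" for k
    proof (rule ccontr)
      assume "?G k \<noteq> {}"
      then obtain y where "y \<in> ?G k"
        by blast
      then have "max_value ?F ?f \<le> ereal (?g k y)"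
        unfolding max_value_def using weak by (auto intro: SUP_least)
      then show False
        using unbounded by simp
    qed
    then show ?thesis
      using unbounded by (simp add: exact_dual_def min_value_def top_ereal_def)
  next
    case bounded
    obtain k0 y where y: "y \<in> ?G k0" "ereal (?g k0 y) = max_value ?F ?f"
      using finite_value_attained[OF assms(1-3) bounded] by blast
    have "exact_dual (?G k) (?g k) ?F ?f" if k: "k \<ge> k0" for k
    proof -
      obtain w where w: "w \<in> ?G k" "?g k w = ?g k0 y"
        using Dext_feasible_mono[OF assms(3) y(1) k] by blast
      with y(2) have "ereal (?g k w) = max_value ?F ?f"
        by simp
      then show ?thesis
        using weak w(1) by (intro exact_dualI_attained(1)[where y = w])
    qed
    then show ?thesis
      by blast
  qed
  moreover have "\<exists>k. \<exists>y\<in>?G k. pre_strict_seq (k + 1) K y \<and>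
      ereal (?g k y) = min_value (?G k) (?g k) \<and> ereal (?g k y) = max_value ?F ?f"
    if bounded: "\<bar>max_value ?F ?f\<bar> \<noteq> \<infinity>"
  proof -
    obtain k y where y: "y \<in> ?G k" "pre_strict_seq (k + 1) K y"
        "ereal (?g k y) = max_value ?F ?f"
      using finite_value_attained[OF assms(1-3) bounded] by blast
    moreover have "min_value (?G k) (?g k) = ereal (?g k y)"
      using weak y by (intro exact_dualI_attained(2)[where y = y])
    ultimately show ?thesis
      by metis
  qed
  ultimately show ?thesis
    by blast
qed

end
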